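(* Let the initial universe set $X$ and the parameter set $E$ both be binary sets (i.e. each has exactly two elements). Then every soft $T_1$-II space $(X,\mathcal{T},E)$ over $X$ is a soft $T_1$-I space.
   Context: Let $X$ be a universe set and $E$ a set of parameters. A soft set $(F,E)$ over $X$ is a mapping $F:E\to\mathcal{P}(X)$. Unions and intersections of soft sets are taken parameterwise: $(F\cup G)(e)=F(e)\cup G(e)$, $(F\cap G)(e)=F(e)\cap G(e)$, and similarly for arbitrary families. $\widetilde{\emptyset}$ and $\widetilde{X}$ denote the soft sets with constant value $\emptyset$ and $X$, respectively. A soft topology on $X$ (with parameter set $E$) is a collection $\mathcal{T}$ of soft sets $(F,E)$ over $X$ which contains $\widetilde{\emptyset}$ and $\widetilde{X}$ and is closed under arbitrary unions and under intersections of two members; $(X,\mathcal{T},E)$ is then called a soft topological space, and members of $\mathcal{T}$ are called soft open sets. For $x\in X$, write $x\,\widehat{\in}\,(F,E)$ if $x\in F(e)$ for all $e\in E$, and $x\,\widehat{\notin}\,(F,E)$ for its negation. For $a\in E$ and $x\in X$, the soft point $P_a^x$ is the soft set with value $\{x\}$ at $a$ and value $\emptyset$ at every other parameter. Write $P_a^x\,\widetilde{\in}\,(F,E)$ if $x\in F(a)$, and $P_a^x\,\widetilde{\notin}\,(F,E)$ for its negation. Two soft points $P_a^x$, $P_b^y$ are different iff $(a,x)\neq(b,y)$. $(X,\mathcal{T},E)$ is a soft $T_1$-I space if for all $x,y\in X$ with $x\neq y$ there are soft open sets $(F,E)$ and $(G,E)$ with $x\,\widehat{\in}\,(F,E)$,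 $y\,\widehat{\notin}\,(F,E)$, $y\,\widehat{\in}\,(G,E)$ and $x\,\widehat{\notin}\,(G,E)$. $(X,\mathcal{T},E)$ is a soft $T_1$-II space if for all soft points $P_a^x\neq P_b^y$ there are soft open sets $(F,E)$ and $(G,E)$ with $P_a^x\,\widetilde{\in}\,(F,E)$, $P_b^y\,\widetilde{\notin}\,(F,E)$, $P_b^y\,\widetilde{\in}\,(G,E)$ and $P_a^x\,\widetilde{\notin}\,(G,E)$. *)

theory Defs
  imports "HOL-Library.FuncSet"
begin

text \<open>
  A soft set over \<open>X\<close> with parameter set \<open>E\<close> is a map \<open>E \<rightarrow> Pow X\<close>. It is represented as an
  extensional function (\<open>undefined\<close> off \<open>E\<close>), so that HOL equality is equality of soft sets.
\<close>

definition soft_sets :: "'x set \<Rightarrow> 'e set \<Rightarrow> ('e \<Rightarrow> 'x set) set" where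
  "soft_sets X E = (E \<rightarrow>\<^sub>E Pow X)"

definition soft_const :: "'e set \<Rightarrow> 'x set \<Rightarrow> 'e \<Rightarrow> 'x set" where
  "soft_const E A = (\<lambda>e\<in>E. A)"

definition soft_inter :: "'e set \<Rightarrow> ('e \<Rightarrow> 'x set) \<Rightarrow> ('e \<Rightarrow> 'x set) \<Rightarrow> 'e \<Rightarrow> 'x set" where
  "soft_inter E F G = (\<lambda>e\<in>E. F e \<inter> G e)"

definition soft_Union :: "'e set \<Rightarrow> ('e \<Rightarrow> 'x set) set \<Rightarrow> 'e \<Rightarrow> 'x set" where
  "soft_Union E S = (\<lambda>e\<in>E. \<Union>F\<in>S. F e)"

definition soft_topology :: "'x set \<Rightarrow> ('e \<Rightarrow> 'x set) set \<Rightarrow> 'e set \<Rightarrow> bool" where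
  "soft_topology X T E \<longleftrightarrow>
     T \<subseteq> soft_sets X E \<and>
     soft_const E {} \<in> T \<and> soft_const E X \<in> T \<and>
     (\<forall>S. S \<subseteq> T \<longrightarrow> soft_Union E S \<in> T) \<and>
     (\<forall>F\<in>T. \<forall>G\<in>T. soft_inter E F G \<in> T)"

text \<open>
  \<open>pt_in E x F\<close> says that \<open>x\<close> lies in \<open>F e\<close> for every parameter \<open>e\<close>; its negation says that
  \<open>x\<close> is missing from \<open>F e\<close> for some \<open>e\<close>, not for all \<open>e\<close>.
\<close>

definition pt_in :: "'e set \<Rightarrow> 'x \<Rightarrow> ('e \<Rightarrow> 'x set) \<Rightarrow> bool" where
  "pt_in E x F \<longleftrightarrow> (\<forall>e\<in>E. x \<in> F e)"

definition soft_point :: "'e set \<Rightarrow> 'e \<Rightarrow> 'x \<Rightarrow> 'e \<Rightarrow> 'x set" where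
  "soft_point E a x = (\<lambda>e\<in>E. if e = a then {x} else {})"

lemma soft_point_eq_iff:
  assumes "a \<in> E" "b \<in> E"
  shows "soft_point E a x = soft_point E b y \<longleftrightarrow> (a, x) = (b, y)"
proof
  assume "soft_point E a x = soft_point E b y"
  then have "soft_point E a x a = soft_point E b y a" by simp
  with assms show "(a, x) = (b, y)"
    by (auto simp: soft_point_def split: if_splits)
qed simp

text \<open>Only meaningful when \<open>P\<close> is a soft point; see \<open>soft_point_in_iff\<close>.\<close>

definition soft_point_in :: "'e set \<Rightarrow> ('e \<Rightarrow> 'x set) \<Rightarrow> ('e \<Rightarrow> 'x set) \<Rightarrow> bool" where
  "soft_point_in E P F \<longleftrightarrow> (\<exists>a\<in>E. \<exists>x. P = soft_point E a x \<and> x \<in> F a)"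

lemma soft_point_in_iff:
  "a \<in> E \<Longrightarrow> soft_point_in E (soft_point E a x) F \<longleftrightarrow> x \<in> F a"
  by (auto simp: soft_point_in_def soft_point_eq_iff)

definition soft_T1_I :: "'x set \<Rightarrow> ('e \<Rightarrow> 'x set) set \<Rightarrow> 'e set \<Rightarrow> bool" where
  "soft_T1_I X T E \<longleftrightarrow> soft_topology X T E \<and>
     (\<forall>x\<in>X. \<forall>y\<in>X. x \<noteq> y \<longrightarrow>
       (\<exists>F\<in>T. \<exists>G\<in>T. pt_in E x F \<and> \<not> pt_in E y F \<and> pt_in E y G \<and> \<not> pt_in E x G))"

definition soft_T1_II :: "'x set \<Rightarrow> ('e \<Rightarrow> 'x set) set \<Rightarrow> 'e set \<Rightarrow> bool" where
  "soft_T1_II X T E \<longleftrightarrow> soft_topology X T E \<and>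
     (\<forall>a\<in>E. \<forall>b\<in>E. \<forall>x\<in>X. \<forall>y\<in>X. soft_point E a x \<noteq> soft_point E b y \<longrightarrow>
       (\<exists>F\<in>T. \<exists>G\<in>T.
          soft_point_in E (soft_point E a x) F \<and> \<not> soft_point_in E (soft_point E b y) F \<and>
          soft_point_in E (soft_point E b y) G \<and> \<not> soft_point_in E (soft_point E a x) G))"

end

theory Submission
  imports Defs
begin

text \<open>
  Fix a parameter \<open>a\<close>. For every parameter \<open>e\<close> the soft point of \<open>x\<close> at \<open>e\<close> has a soft open
  neighbourhood missing the soft point of \<open>y\<close> at \<open>a\<close>; the union of these neighbourhoods contains
  \<open>x\<close> at every parameter and still misses \<open>y\<close> at \<open>a\<close>.
\<close>

lemma soft_T1_II_separate:
  assumes T1: "soft_T1_II X T E" and "E \<noteq> {}" and "x \<in> X" "y \<in> X" "x \<noteq> y"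
  shows "\<exists>F\<in>T. pt_in E x F \<and> \<not> pt_in E y F"
proof -
  from \<open>E \<noteq> {}\<close> obtain a where a: "a \<in> E" by blast
  \<comment> \<open>All soft open sets missing \<open>y\<close> at \<open>a\<close> are collected,
    so no neighbourhood has to be chosen for each parameter.\<close>
  define S where "S = {F \<in> T. y \<notin> F a}"
  have "\<exists>F\<in>S. x \<in> F e" if e: "e \<in> E" for e
  proof -
    \<comment> \<open>The points differ because \<open>x \<noteq> y\<close>, which also covers
      \<open>e = a\<close>.\<close>
    have "soft_point E e x \<noteq> soft_point E a y"
      using e a \<open>x \<noteq> y\<close> by (simp add: soft_point_eq_iff)
    then obtain F where "F \<in> T" "soft_point_in E (soft_point E e x) F"
      "\<not> soft_point_in E (soft_point E a y) F"
      using T1 e a \<open>x \<in> X\<close> \<open>y \<in> X\<close> unfolding soft_T1_II_def by blast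
    then show ?thesis
      using e a by (auto simp: S_def soft_point_in_iff)
  qed
  then have "pt_in E x (soft_Union E S)"
    by (auto simp: pt_in_def soft_Union_def)
  moreover have "\<not> pt_in E y (soft_Union E S)"
    using a by (auto simp: pt_in_def soft_Union_def S_def)
  moreover have "soft_Union E S \<in> T"
    using T1 unfolding soft_T1_II_def soft_topology_def S_def by simp
  ultimately show ?thesis by blast
qed

text \<open>The separation is one-sided, so \<open>G\<close> comes from exchanging \<open>x\<close>
  and \<open>y\<close>.\<close>

lemma soft_T1_II_imp_soft_T1_I:
  assumes "soft_T1_II X T E" and "E \<noteq> {}"
  shows "soft_T1_I X T E"
  unfolding soft_T1_I_def
proof (intro conjI ballI impI)
  show "soft_topology X T E"
    using assms(1) by (simp add: soft_T1_II_def)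
next
  fix x y assume "x \<in> X" "y \<in> X" "x \<noteq> y"
  then show "\<exists>F\<in>T. \<exists>G\<in>T. pt_in E x F \<and> \<not> pt_in E y F \<and> pt_in E y G \<and> \<not> pt_in E x G"
    using soft_T1_II_separate[OF assms, of x y] soft_T1_II_separate[OF assms, of y x] by blast
qed

theorem proposition3p4:
  fixes X :: "'x set" and E :: "'e set" and T :: "('e \<Rightarrow> 'x set) set"
  assumes "card X = 2" and "card E = 2"
    and "soft_T1_II X T E"
  shows "soft_T1_I X T E"
  \<comment> \<open>\<open>E \<noteq> {}\<close> follows from \<open>card E = 2\<close>, as
    \<open>card {} = 0\<close>.\<close>
  using assms by (intro soft_T1_II_imp_soft_T1_I) auto

end
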